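(* Let $f_i:\mathbb{R}^n\to\mathbb{R}$, $i=1,\dots,m$, be convex and twice continuously differentiable, and suppose that $f=\sum_{i=1}^mf_i$ is strongly convex with constant $c>0$, i.e. $f(x)-\frac c2\|x\|^2$ is convex on $\mathbb{R}^n$. Let $x^*$ be the unique minimizer of $f$. Consider the iterates $\{x_1^k,x_2^k,\dots,x_m^k\}_{k\ge1}$ of the incremental gradient (IG) method with stepsize $\alpha_k=R/k^s$, where $R>0$ and $s\in[0,1]$. Suppose that these iterates are uniformly bounded, i.e. there is a non-empty compact Euclidean ball $\mathcal{X}\subset\mathbb{R}^n$ that contains all of them. Let $G$ be a constant with $\max_{1\le i\le m}\sup_{x\in\mathcal{X}}\|\nabla f_i(x)\|\le G$, let $L_i=\max_{z\in\mathcal{X}}\|\nabla^2f_i(z)\|$, $L=\sum_{i=1}^mL_i$, and $\widetilde M=LGm$. Let $\mathrm{dist}_k=\|x_1^k-x^*\|$. Then: (i) If $s=1$, then $$\limsup_{k\to\infty} k\,\mathrm{dist}_k\le\frac{R^2\widetilde M}{Rc-1}\quad\text{for } R>1/c,$$ $$\limsup_{k\to\infty}\frac{k}{\log k}\,\mathrm{dist}_k<\infty\quad\text{for } R=1/c,$$ $$\limsup_{k\to\infty}k^{Rc}\,\mathrm{dist}_k<\infty\quad\text{for } R<1/c.$$ (ii) If $0<s<1$, then $$\limsup_{k\to\infty}k^s\,\mathrm{dist}_k\le\frac{R\widetilde M}{c}.$$ (iii) If $s=0$ and $R\le\frac1L$, then $$\mathrm{dist}_{k+1}\le(1-c\alpha)^k\,\mathrm{dist}_1+\frac{\alpha\widetilde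 M}{c}\qquad\text{for all } k\ge1,$$ where $\alpha=\alpha_k=R$ is the constant stepsize.
   Context: The IG method for minimizing $f=\sum_{i=1}^mf_i$ with stepsizes $\alpha_k>0$: from an initial point $x_1^1\in\mathbb{R}^n$, for each $k\ge1$ set $x_{i+1}^k=x_i^k-\alpha_k\nabla f_i(x_i^k)$ for $i=1,\dots,m$, and $x_1^{k+1}=x_{m+1}^k$. The norm $\|\cdot\|$ is the Euclidean norm for vectors and the spectral norm for matrices. *)

theory Defs
  imports "HOL-Analysis.Analysis"
begin

definition gradient :: "(real ^ 'n \<Rightarrow> real) \<Rightarrow> real ^ 'n \<Rightarrow> real ^ 'n" where
  "gradient f x = (THE D. GDERIV f x :> D)"

definition hessian :: "(real ^ 'n \<Rightarrow> real) \<Rightarrow> real ^ 'n \<Rightarrow> real ^ 'n ^ 'n" where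
  "hessian f x = jacobian (gradient f) (at x)"

definition twice_continuously_differentiable :: "(real ^ 'n \<Rightarrow> real) \<Rightarrow> bool" where
  "twice_continuously_differentiable f \<longleftrightarrow>
     (\<forall>x. f differentiable (at x)) \<and>
     (\<forall>x. gradient f differentiable (at x)) \<and>
     continuous_on UNIV (hessian f)"

(* The library's norm on real ^ 'n ^ 'm is the Frobenius norm; the spectral norm is the
   operator norm induced by the Euclidean norms. *)
definition spectral_norm :: "real ^ 'n ^ 'm \<Rightarrow> real" where
  "spectral_norm A = onorm ((*v) A)"

definition strongly_convex :: "real \<Rightarrow> ('a::real_normed_vector \<Rightarrow> real) \<Rightarrow> bool" where
  "strongly_convex c f \<longleftrightarrow> convex_on UNIV (\<lambda>x. f x - c / 2 * (norm x)\<^sup>2)"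

(* x k i stands for the inner iterate with superscript k (cycle) and subscript i; only
   k >= 1 and 1 <= i <= m + 1 matter. *)
definition incremental_gradient ::
  "nat \<Rightarrow> (nat \<Rightarrow> real ^ 'n \<Rightarrow> real) \<Rightarrow> (nat \<Rightarrow> real) \<Rightarrow> (nat \<Rightarrow> nat \<Rightarrow> real ^ 'n) \<Rightarrow> bool" where
  "incremental_gradient m f \<alpha> x \<longleftrightarrow>
     (\<forall>k\<ge>1. (\<forall>i\<in>{1..m}. x k (i + 1) = x k i - \<alpha> k *\<^sub>R gradient (f i) (x k i)) \<and>
             x (k + 1) 1 = x k (m + 1))"

end

theory Submission
  imports Defs "HOL-Real_Asymp.Real_Asymp"
begin

text \<open>
  Write \<open>u\<close> and \<open>v\<close> for the displacements of two consecutive outer iterates from the minimizer,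
  and \<open>\<alpha>\<close> for the stepsize of the cycle between them. One cycle is a full gradient step with an
  error: \<open>v = u - \<alpha> (\<nabla>F - e)\<close>, where \<open>e\<close> collects the differences between the component gradients
  at the start of the cycle and at the inner iterates. Since an inner iterate is within
  \<open>\<alpha> G m\<close> of the start, \<open>\<parallel>e\<parallel> \<le> \<alpha> M\<close>. If the exact gradient step contracted by \<open>1 - c \<alpha>\<close>, the
  distances would satisfy \<open>\<parallel>v\<parallel> \<le> (1 - c \<alpha>) \<parallel>u\<parallel> + \<alpha>\<^sup>2 M\<close>, and everything would follow from that
  recursion.

  The contraction by \<open>1 - c \<alpha>\<close> is usually read off from Hessians on the segment from the iterate to
  the minimizer. Here the Hessians are controlled only on the ball \<open>X\<close> of the iterates, and
  the minimizer may lie outside. The argument below therefore never compares gradients outside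
  \<open>X\<close>: it combines the descent inequality between the two iterates, which both lie in \<open>X\<close>, with
  the two global strong convexity inequalities through the minimizer. With \<open>q = c \<alpha>\<close> and
  \<open>l = \<alpha> L \<le> 1\<close> this gives
  \<open>(1 + q) \<parallel>v\<parallel>\<^sup>2 - 2 \<alpha> \<parallel>e\<parallel> \<parallel>v\<parallel> \<le> (1 - q) \<parallel>u\<parallel>\<^sup>2 - (1 - l) \<parallel>u - v\<parallel>\<^sup>2\<close>.
  Dropping the last term would only yield the contraction factor \<open>sqrt ((1 - q) / (1 + q))\<close>, which
  exceeds \<open>1 - q\<close> by a term of order \<open>q\<^sup>2\<close>. The deficit is made up by a dichotomy. The error can be
  close to its bound only if some inner iterate has moved away from the start by almost the whole
  length \<open>\<alpha> G m\<close> available to a cycle; then little length remains for turning back, so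
  \<open>\<parallel>u - v\<parallel>\<close> is large. Otherwise the error bound has room to spare. The outcome
  (\<open>quadratic_recursion_imp_linear\<close>, \<open>incremental_cycle_bound\<close>) is
  \<open>\<parallel>v\<parallel> \<le> max ((1 - c \<alpha>) \<parallel>u\<parallel> + \<alpha>\<^sup>2 M) (\<alpha> M / c)\<close>.
  The second argument of the maximum is the fixed point of the affine map in the first, so it
  does not affect any of the bounds.

  For a constant stepsize this recursion is iterated directly. For stepsizes \<open>R / k\<^sup>s\<close> with \<open>s > 0\<close>
  the condition \<open>\<alpha> L \<le> 1\<close> holds eventually, and the distances are compared with explicit
  supersolutions \<open>A k + C H k\<close>: the sequence \<open>A\<close> dominates the inhomogeneous recursion, the sequence
  \<open>H\<close> dominates the homogeneous one, and \<open>C\<close> absorbs the unknown initial distance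
  (\<open>recursion_bounded_by_supersolution\<close>). A negative power \<open>k\<^sup>-\<^sup>t\<close> serves as \<open>H\<close>, because
  \<open>(1 + 1/k)\<^sup>-\<^sup>t \<ge> 1 - t/k\<close>.
\<close>

section \<open>Gradients, smoothness and strong convexity\<close>

lemma has_derivative_gradient:
  fixes f :: "real ^ 'n \<Rightarrow> real"
  assumes "f differentiable (at x)"
  shows "(f has_derivative (\<lambda>h. gradient f x \<bullet> h)) (at x)"
proof -
  obtain f' where f': "(f has_derivative f') (at x)"
    using assms by (auto simp: differentiable_def)
  then have lin: "linear f'" by (rule has_derivative_linear)
  (* the Riesz representative of the derivative *)
  define D where "D = adjoint f' 1"
  have "f' = (\<lambda>h. h \<bullet> D)"
    using adjoint_works[OF lin, of _ 1] by (simp add: D_def fun_eq_iff)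
  then have gD: "GDERIV f x :> D"
    using f' by (simp add: gderiv_def)
  have "D' = D" if "GDERIV f x :> D'" for D'
  proof -
    have "(\<lambda>h. h \<bullet> D') = (\<lambda>h. h \<bullet> D)"
      using that gD unfolding gderiv_def by (rule has_derivative_unique)
    then show ?thesis by (metis vector_eq_ldot)
  qed
  with gD have "gradient f x = D"
    unfolding gradient_def by blast
  then show ?thesis
    using gD by (simp add: gderiv_def inner_commute)
qed

text \<open>The norm of the matrix type is the Frobenius norm. Continuity of the Hessian refers to it,
  so it provides the upper bound that makes the supremum of the spectral norms finite.\<close>

lemma spectral_norm_le_norm: "spectral_norm A \<le> norm A"
  unfolding spectral_norm_def
proof (rule onorm_bound)
  show "norm (A *v x) \<le> norm A * norm x" for x
  proof -
    have "norm (A *v x) = L2_set (\<lambda>i. A $ i \<bullet> x) UNIV"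
      by (simp add: norm_vec_def L2_set_def matrix_mult_dot inner_vec_def)
    also have "\<dots> \<le> L2_set (\<lambda>i. norm (A $ i) * norm x) UNIV"
      unfolding L2_set_def
      by (intro real_sqrt_le_mono sum_mono abs_le_square_iff[THEN iffD1])
        (simp add: Cauchy_Schwarz_ineq2)
    also have "\<dots> = norm A * norm x"
      by (simp add: L2_set_left_distrib norm_vec_def)
    finally show ?thesis .
  qed
qed simp

lemma spectral_norm_nonneg: "0 \<le> spectral_norm A"
  unfolding spectral_norm_def by (simp add: onorm_pos_le)

lemma bdd_above_spectral_norm_hessian:
  assumes "twice_continuously_differentiable f" and "compact X"
  shows "bdd_above ((\<lambda>z. spectral_norm (hessian f z)) ` X)"
proof -
  have "compact (hessian f ` X)"
    using assms unfolding twice_continuously_differentiable_def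
    by (meson compact_continuous_image continuous_on_subset subset_UNIV)
  then obtain B where "\<forall>A\<in>hessian f ` X. norm A \<le> B"
    using compact_imp_bounded bounded_iff by blast
  then show ?thesis
    by (auto intro!: bdd_aboveI[where M = B] intro: order_trans[OF spectral_norm_le_norm])
qed

lemma gradient_lipschitz:
  assumes f: "twice_continuously_differentiable f" and X: "compact X" "convex X"
    and "p \<in> X" "q \<in> X"
  shows "norm (gradient f p - gradient f q)
           \<le> (SUP z\<in>X. spectral_norm (hessian f z)) * norm (p - q)"
proof (rule differentiable_bound[OF X(2), where f' = "\<lambda>z. (*v) (hessian f z)"])
  fix z assume "z \<in> X"
  then show "onorm ((*v) (hessian f z)) \<le> (SUP z\<in>X. spectral_norm (hessian f z))"
    using bdd_above_spectral_norm_hessian[OF f X(1)]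
    by (auto simp: spectral_norm_def intro: cSUP_upper2)
  show "(gradient f has_derivative (*v) (hessian f z)) (at z within X)"
    using f jacobian_works[of "gradient f" "at z"]
    by (auto simp: hessian_def twice_continuously_differentiable_def
        intro: has_derivative_at_withinI)
qed (use assms in auto)

text \<open>The difference between the two sides of the descent inequality is nonincreasing along the
  segment from \<open>p\<close> to \<open>w\<close>, because there the gradient has drifted by at most \<open>K t \<parallel>w - p\<parallel>\<close> at
  time \<open>t\<close>. Only the behaviour on the convex set \<open>X\<close> matters.\<close>

lemma descent_inequality:
  fixes f :: "real ^ 'n \<Rightarrow> real"
  assumes f: "\<And>z. f differentiable (at z)" and X: "convex X" "p \<in> X" "w \<in> X"
    and K: "\<And>y z. y \<in> X \<Longrightarrow> z \<in> X \<Longrightarrow> norm (gradient f y - gradient f z) \<le> K * norm (y - z)"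
  shows "f w \<le> f p + gradient f p \<bullet> (w - p) + K / 2 * (norm (w - p))\<^sup>2"
proof -
  define h where "h = w - p"
  define \<phi> where
    "\<phi> t = f (p + t *\<^sub>R h) - t * (gradient f p \<bullet> h) - K / 2 * t\<^sup>2 * (norm h)\<^sup>2" for t
  have "\<phi> 0 \<ge> \<phi> 1"
  proof (rule DERIV_nonpos_imp_nonincreasing[where f = \<phi>])
    fix t :: real assume t: "0 \<le> t" "t \<le> 1"
    define z where "z = p + t *\<^sub>R h"
    have "z = (1 - t) *\<^sub>R p + t *\<^sub>R w"
      by (simp add: z_def h_def algebra_simps)
    then have "z \<in> X"
      using X t by (simp add: convexD_alt)
    have "((\<lambda>t. f (p + t *\<^sub>R h)) has_derivative (\<lambda>s. gradient f z \<bullet> (s *\<^sub>R h))) (at t)"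
      by (rule has_derivative_compose[of "\<lambda>t. p + t *\<^sub>R h" "\<lambda>s. s *\<^sub>R h" t UNIV f])
        (use has_derivative_gradient[OF f, of z] in \<open>auto simp: z_def intro!: derivative_eq_intros\<close>)
    then have "((\<lambda>t. f (p + t *\<^sub>R h)) has_real_derivative (gradient f z \<bullet> h)) (at t)"
      by (simp add: has_field_derivative_def mult_commute_abs)
    then have deriv: "(\<phi> has_real_derivative
        (gradient f z \<bullet> h - gradient f p \<bullet> h - K * t * (norm h)\<^sup>2)) (at t)"
      unfolding \<phi>_def by (auto intro!: derivative_eq_intros)
    have "(gradient f z - gradient f p) \<bullet> h \<le> norm (gradient f z - gradient f p) * norm h"
      by (rule norm_cauchy_schwarz)
    also have "\<dots> \<le> K * norm (z - p) * norm h"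
      by (intro mult_right_mono K \<open>z \<in> X\<close> X) auto
    also have "\<dots> = K * t * (norm h)\<^sup>2"
      using t by (simp add: z_def power2_eq_square)
    finally show "\<exists>y. (\<phi> has_real_derivative y) (at t) \<and> y \<le> 0"
      using deriv by (intro exI[of _ "gradient f z \<bullet> h - gradient f p \<bullet> h - K * t * (norm h)\<^sup>2"])
        (simp add: inner_diff_left)
  qed simp
  then show ?thesis
    by (simp add: \<phi>_def h_def)
qed

text \<open>Restricted to a line, \<open>F - c/2 \<parallel>\<cdot>\<parallel>\<^sup>2\<close> is a convex function of one real variable and lies
  above its tangents; completing the square turns this into the bound on \<open>F\<close>.\<close>

lemma strongly_convex_above_tangent:
  fixes F :: "real ^ 'n \<Rightarrow> real"
  assumes F: "strongly_convex c F" and g: "(F has_derivative (\<lambda>h. g \<bullet> h)) (at p)"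
  shows "F w \<ge> F p + g \<bullet> (w - p) + c / 2 * (norm (w - p))\<^sup>2"
proof -
  define h where "h = w - p"
  define k where "k z = F z - c / 2 * (norm z)\<^sup>2" for z
  have k: "convex_on UNIV k"
    using F unfolding k_def strongly_convex_def .
  define \<psi> where "\<psi> t = k (p + t *\<^sub>R h)" for t
  have cvx: "convex_on UNIV \<psi>"
    unfolding convex_on_def
  proof (intro conjI ballI allI impI)
    fix s t u v :: real assume uv: "0 \<le> u" "0 \<le> v" "u + v = 1"
    have "p + (u * s + v * t) *\<^sub>R h = (u + v) *\<^sub>R p + (u * s + v * t) *\<^sub>R h"
      using uv by simp
    also have "\<dots> = u *\<^sub>R (p + s *\<^sub>R h) + v *\<^sub>R (p + t *\<^sub>R h)"
      by (simp only: algebra_simps scaleR_scaleR scaleR_add_left scaleR_add_right)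
    finally show "\<psi> (u *\<^sub>R s + v *\<^sub>R t) \<le> u * \<psi> s + v * \<psi> t"
      using k uv by (simp add: \<psi>_def convex_on_def)
  qed simp
  have eq: "k (p + t *\<^sub>R h) = F (p + t *\<^sub>R h) - c / 2 * (p \<bullet> p + 2 * t * (p \<bullet> h) + t\<^sup>2 * (h \<bullet> h))" for t
    unfolding k_def power2_norm_eq_inner
    by (simp add: inner_commute algebra_simps power2_eq_square)
  have "((\<lambda>t. F (p + t *\<^sub>R h)) has_derivative (\<lambda>s. g \<bullet> (s *\<^sub>R h))) (at 0)"
    by (rule has_derivative_compose[of "\<lambda>t. p + t *\<^sub>R h" "\<lambda>s. s *\<^sub>R h" 0 UNIV F])
      (use g in \<open>auto intro!: derivative_eq_intros\<close>)
  then have "((\<lambda>t. F (p + t *\<^sub>R h)) has_real_derivative (g \<bullet> h)) (at 0)"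
    by (simp add: has_field_derivative_def mult_commute_abs)
  then have "(\<psi> has_real_derivative (g \<bullet> h - c * (p \<bullet> h))) (at 0)"
    unfolding \<psi>_def eq by (auto intro!: derivative_eq_intros simp: field_simps)
  then have "\<psi> 1 - \<psi> 0 \<ge> (g \<bullet> h - c * (p \<bullet> h)) * (1 - 0)"
    by (intro convex_on_imp_above_tangent[OF cvx]) auto
  then show ?thesis
    unfolding \<psi>_def eq by (simp add: h_def power2_norm_eq_inner algebra_simps)
qed

lemma gradient_zero_at_minimizer:
  fixes F :: "real ^ 'n \<Rightarrow> real"
  assumes F: "(F has_derivative (\<lambda>h. g \<bullet> h)) (at xs)" and min: "is_arg_min F (\<lambda>_. True) xs"
  shows "g = 0"
proof -
  have "(\<lambda>h. g \<bullet> h) = (\<lambda>h. 0)"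
    using differential_zero_maxmin[of xs UNIV F "\<lambda>h. g \<bullet> h"] F min
    by (auto simp: is_arg_min_linorder)
  then show ?thesis by (metis inner_eq_zero_iff)
qed

text \<open>A single pair of distinct points at which both quadratic bounds hold already orders the
  two constants.\<close>

lemma strong_convexity_le_smoothness:
  fixes F :: "'a::real_inner \<Rightarrow> real" and g :: "'a \<Rightarrow> 'a"
  assumes below: "\<And>p w. F w \<ge> F p + g p \<bullet> (w - p) + c / 2 * (norm (w - p))\<^sup>2"
    and above: "F w \<le> F p + g p \<bullet> (w - p) + L / 2 * (norm (w - p))\<^sup>2" and "p \<noteq> w"
  shows "c \<le> L"
proof -
  have "c / 2 * (norm (w - p))\<^sup>2 \<le> L / 2 * (norm (w - p))\<^sup>2"
    using below[of p w] above by linarith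
  then show ?thesis using \<open>p \<noteq> w\<close> by simp
qed

section \<open>The distance to the minimizer over one cycle\<close>

text \<open>In the application \<open>u\<close> and \<open>v\<close> are the distances to the minimizer before and after a cycle,
  \<open>d\<close> is the length of the displacement, \<open>e\<close> is the stepsize times the norm of the gradient error,
  and \<open>D\<close> bounds the length of the path. The number \<open>K = l D / q\<close> is the fixed point of
  \<open>u \<mapsto> (1 - q) u + l D\<close>. For \<open>u \<le> K\<close> the quadratic inequality alone gives \<open>v \<le> K\<close>. For \<open>u \<ge> K\<close>,
  put \<open>\<delta> = q u - l D\<close>. At \<open>v = (1 - q) u + l D\<close> with \<open>e = l D\<close> the left side of the quadratic
  inequality is exactly \<open>(1 - q) u\<^sup>2 - (1 - q) \<delta>\<^sup>2\<close>, so a larger \<open>v\<close> forces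
  \<open>(1 - l) d\<^sup>2 + 2 (l D - e) ((1 - q) u + l D) < (1 - q) \<delta>\<^sup>2\<close>. Either branch of the
  alternative \<open>alt\<close> contradicts this, since \<open>\<delta> \<le> (1 - l) D\<close> and \<open>\<delta> \<le> d\<close>.\<close>

lemma quadratic_recursion_imp_linear:
  fixes q l D u v e d :: real
  assumes q: "0 < q" "q \<le> l" and l: "l \<le> 1" and nonneg: "0 \<le> D" "0 \<le> u" "0 \<le> v"
    and quad: "(1 + q) * v\<^sup>2 - 2 * e * v \<le> (1 - q) * u\<^sup>2 - (1 - l) * d\<^sup>2"
    and u: "q * u \<le> D" and e: "e \<le> l * D" and d: "q * u - l * D \<le> d"
    and alt: "(1 - q) * D \<le> d \<or> e \<le> l * (1 - q / 2) * D"
  shows "v \<le> max ((1 - q) * u + l * D) (l * D / q)"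
proof (cases "q * u \<ge> l * D")
  case False
  define K where "K = l * D / q"
  have qK: "l * D = q * K" using q by (simp add: K_def)
  have "u \<le> K" "0 \<le> K" using False q nonneg l by (auto simp: K_def field_simps)
  show ?thesis
  proof (rule ccontr)
    assume "\<not> ?thesis"
    then have "K < v" by (simp add: K_def)
    have "e * v \<le> q * K * v" using e qK nonneg by (simp add: mult_right_mono)
    moreover have "(1 - q) * u\<^sup>2 \<le> (1 - q) * K\<^sup>2"
      using q l nonneg \<open>u \<le> K\<close> by (intro mult_left_mono power_mono) auto
    moreover have "0 \<le> (1 - l) * d\<^sup>2" using l by simp
    ultimately have "(1 + q) * v\<^sup>2 - 2 * (q * K * v) - (1 - q) * K\<^sup>2 \<le> 0"
      using quad by linarith
    moreover have "(1 + q) * v\<^sup>2 - 2 * (q * K * v) - (1 - q) * K\<^sup>2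
        = (v - K) * ((1 + q) * v + (1 - q) * K)"
      by (simp add: algebra_simps power2_eq_square)
    moreover have "0 < (v - K) * ((1 + q) * v + (1 - q) * K)"
      using \<open>K < v\<close> \<open>0 \<le> K\<close> q l by (intro mult_pos_pos add_pos_nonneg) auto
    ultimately show False by linarith
  qed
next
  case True
  define b where "b = (1 - q) * u + l * D"
  define \<delta> where "\<delta> = q * u - l * D"
  have \<delta>: "0 \<le> \<delta>" "\<delta> \<le> d" using True d by (auto simp: \<delta>_def)
  have b: "0 \<le> b" "l * D \<le> b" using q l nonneg by (auto simp: b_def)
  have \<delta>D: "\<delta> \<le> (1 - l) * D" using u by (simp add: \<delta>_def algebra_simps)
  show ?thesis
  proof (rule ccontr)
    assume "\<not> ?thesis"
    then have vb: "b < v" by (simp add: b_def)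
    have "(1 + q) * b\<^sup>2 - 2 * e * b < (1 + q) * v\<^sup>2 - 2 * e * v"
    proof -
      have "(1 + q) * v\<^sup>2 - 2 * e * v - ((1 + q) * b\<^sup>2 - 2 * e * b)
          = (v - b) * ((1 + q) * (v + b) - 2 * e)"
        by (simp add: algebra_simps power2_eq_square)
      moreover have "(1 + q) * (v + b) - 2 * e > 0"
      proof -
        have "q * (v + b) \<ge> 0" using q nonneg b by simp
        then show ?thesis using e vb b by (simp add: algebra_simps)
      qed
      ultimately show ?thesis using vb by (smt (verit) mult_pos_pos)
    qed
    then have lt: "(1 + q) * b\<^sup>2 - 2 * e * b < (1 - q) * u\<^sup>2 - (1 - l) * d\<^sup>2"
      using quad by linarith
    have key: "(1 + q) * b\<^sup>2 - 2 * (l * D) * b = (1 - q) * u\<^sup>2 - (1 - q) * \<delta>\<^sup>2"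
      by (simp add: b_def \<delta>_def power2_eq_square algebra_simps)
    have gap: "(1 - l) * d\<^sup>2 + 2 * (l * D - e) * b < (1 - q) * \<delta>\<^sup>2"
      using lt key by (simp add: algebra_simps)
    from alt show False
    proof
      assume dq: "(1 - q) * D \<le> d"
      have "\<delta>\<^sup>2 \<le> ((1 - l) * D)\<^sup>2" using \<delta> \<delta>D by (intro power_mono) auto
      also have "\<dots> = (1 - l) * ((1 - l) * D\<^sup>2)" by (simp add: power2_eq_square)
      also have "\<dots> \<le> (1 - l) * ((1 - q) * D\<^sup>2)"
        using q l by (intro mult_left_mono mult_right_mono) auto
      finally have "(1 - q) * \<delta>\<^sup>2 \<le> (1 - q) * ((1 - l) * ((1 - q) * D\<^sup>2))"
        using q l by (intro mult_left_mono) auto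
      also have "\<dots> = (1 - l) * ((1 - q) * D)\<^sup>2" by (simp add: power2_eq_square)
      also have "\<dots> \<le> (1 - l) * d\<^sup>2"
        using dq q l nonneg by (intro mult_left_mono power_mono) auto
      finally show False using gap b e by (smt (verit) mult_nonneg_nonneg)
    next
      assume eq: "e \<le> l * (1 - q / 2) * D"
      have "(1 - l) * \<delta>\<^sup>2 \<le> (1 - l) * d\<^sup>2"
        using \<delta> l by (intro mult_left_mono power_mono) auto
      moreover have "(l * D * q) * b \<le> 2 * (l * D - e) * b"
        using eq b by (intro mult_right_mono) (auto simp: algebra_simps)
      moreover have "(l - q) * \<delta>\<^sup>2 \<le> (l * D * q) * b"
      proof -
        have "\<delta> \<le> q * u" using q l nonneg by (simp add: \<delta>_def)
        then have "\<delta>\<^sup>2 \<le> (q * u) * ((1 - l) * D)"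
          unfolding power2_eq_square using \<delta> \<delta>D q nonneg by (intro mult_mono) auto
        also have "\<dots> \<le> (q * u) * ((1 - q) * D)"
          using q l nonneg by (intro mult_left_mono mult_right_mono) auto
        finally have "(l - q) * \<delta>\<^sup>2 \<le> l * ((q * u) * ((1 - q) * D))"
          using q by (intro mult_mono) auto
        also have "\<dots> = (l * D * q) * ((1 - q) * u)" by simp
        also have "\<dots> \<le> (l * D * q) * b"
          using q l nonneg by (intro mult_left_mono) (auto simp: b_def)
        finally show ?thesis .
      qed
      ultimately show False using gap by (simp add: algebra_simps)
    qed
  qed
qed

text \<open>The lower bound \<open>below\<close> is global because it is used at \<open>xs\<close>, which need not belong to \<open>X\<close>.
  The upper bound \<open>above\<close> is used between the two ends of the cycle, which lie in \<open>X\<close>. For a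
  stationary point outside \<open>X\<close> this pair of bounds replaces the contraction property of an exact
  gradient step.\<close>

lemma incremental_cycle_bound:
  fixes g :: "nat \<Rightarrow> 'a::real_inner \<Rightarrow> 'a" and z :: "nat \<Rightarrow> 'a"
  assumes step: "\<And>i. i \<in> {1..m} \<Longrightarrow> z (i + 1) = z i - \<alpha> *\<^sub>R g i (z i)"
    and inX: "\<And>i. i \<in> {1..m + 1} \<Longrightarrow> z i \<in> X"
    and lip: "\<And>i p w. i \<in> {1..m} \<Longrightarrow> p \<in> X \<Longrightarrow> w \<in> X \<Longrightarrow>
                norm (g i p - g i w) \<le> Li i * norm (p - w)"
    and G: "\<And>i p. i \<in> {1..m} \<Longrightarrow> p \<in> X \<Longrightarrow> norm (g i p) \<le> G"
    and Li: "\<And>i. i \<in> {1..m} \<Longrightarrow> 0 \<le> Li i" and L: "L = (\<Sum>i=1..m. Li i)"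
    and below: "\<And>p w. F w \<ge> F p + (\<Sum>i=1..m. g i p) \<bullet> (w - p) + c / 2 * (norm (w - p))\<^sup>2"
    and above: "\<And>p w. p \<in> X \<Longrightarrow> w \<in> X \<Longrightarrow>
                  F w \<le> F p + (\<Sum>i=1..m. g i p) \<bullet> (w - p) + L / 2 * (norm (w - p))\<^sup>2"
    and crit: "(\<Sum>i=1..m. g i xs) = 0"
    and c: "0 < c" "c \<le> L" and \<alpha>: "0 < \<alpha>" "\<alpha> * L \<le> 1" and m: "1 \<le> m"
  shows "norm (z (m + 1) - xs)
           \<le> max ((1 - c * \<alpha>) * norm (z 1 - xs) + \<alpha>\<^sup>2 * (L * G * real m))
                 (\<alpha> * (L * G * real m) / c)"
proof -
  define u where "u = z 1 - xs"
  define v where "v = z (m + 1) - xs"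
  define grad where "grad = (\<Sum>i=1..m. g i (z 1))"
  define E where "E = \<alpha> *\<^sub>R (\<Sum>i=1..m. g i (z 1) - g i (z i))"
  define q where "q = c * \<alpha>"
  define l where "l = \<alpha> * L"
  define D where "D = real m * \<alpha> * G"
  define d where "d = norm (u - v)"
  have G0: "0 \<le> G"
    using G[of 1 "z 1"] inX[of 1] m order_trans[OF norm_ge_zero[of "g 1 (z 1)"]] by simp
  have D0: "0 \<le> D" using G0 \<alpha> by (simp add: D_def)
  have ql: "0 < q" "q \<le> l" "l \<le> 1" using c \<alpha> by (auto simp: q_def l_def mult.commute)
  have path: "norm (z (i + n) - z i) \<le> real n * (\<alpha> * G)" if "1 \<le> i" "i + n \<le> m + 1" for i n
    using that
  proof (induction n)
    case (Suc n)
    have "z (i + Suc n) - z i = (z (i + n) - z i) - \<alpha> *\<^sub>R g (i + n) (z (i + n))"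
      using step[of "i + n"] Suc.prems by (simp add: algebra_simps)
    then have "norm (z (i + Suc n) - z i)
        \<le> norm (z (i + n) - z i) + norm (\<alpha> *\<^sub>R g (i + n) (z (i + n)))"
      by (metis norm_triangle_ineq4)
    also have "\<dots> \<le> real n * (\<alpha> * G) + \<alpha> * G"
      using Suc G[of "i + n" "z (i + n)"] inX[of "i + n"] \<alpha> by (intro add_mono) auto
    finally show ?case by (simp add: algebra_simps)
  qed simp
  have total: "z (n + 1) = z 1 - \<alpha> *\<^sub>R (\<Sum>i=1..n. g i (z i))" if "n \<le> m" for n
    using that
  proof (induction n)
    case (Suc n)
    then have "z (Suc n + 1) = z 1 - \<alpha> *\<^sub>R (\<Sum>i=1..n. g i (z i)) - \<alpha> *\<^sub>R g (Suc n) (z (Suc n))"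
      using step[of "Suc n"] by simp
    then show ?case by (simp add: scaleR_add_right)
  qed simp
  have v: "v = u - \<alpha> *\<^sub>R grad + E"
    using total[of m] by (simp add: u_def v_def grad_def E_def sum_subtractf algebra_simps)
  have z1: "z 1 \<in> X" and zm: "z (m + 1) \<in> X" using inX by auto

  (* F at the end of the cycle is bounded above from its start and below from xs, and F xs is
     bounded below from the start; adding the three inequalities cancels all values of F. *)
  have quad: "(1 + q) * (norm v)\<^sup>2 - 2 * norm E * norm v \<le> (1 - q) * (norm u)\<^sup>2 - (1 - l) * d\<^sup>2"
  proof -
    have "c / 2 * ((norm u)\<^sup>2 + (norm v)\<^sup>2) - L / 2 * d\<^sup>2 \<le> grad \<bullet> v"
      using below[of xs "z (m + 1)"] below[of "z 1" xs] above[OF z1 zm] crit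
      by (simp add: u_def v_def d_def grad_def norm_minus_commute inner_diff_right field_simps)
    then have "\<alpha> * (c / 2 * ((norm u)\<^sup>2 + (norm v)\<^sup>2) - L / 2 * d\<^sup>2) \<le> (\<alpha> *\<^sub>R grad) \<bullet> v"
      using \<alpha> by (simp add: mult_left_mono)
    also have "\<alpha> *\<^sub>R grad = u - v + E" using v by (simp add: algebra_simps)
    also have "(u - v + E) \<bullet> v = (u - v) \<bullet> v + E \<bullet> v" by (simp add: inner_add_left)
    also have "\<dots> \<le> (u - v) \<bullet> v + norm E * norm v"
      by (simp add: norm_cauchy_schwarz)
    also have "(u - v) \<bullet> v = ((norm u)\<^sup>2 - (norm v)\<^sup>2 - d\<^sup>2) / 2"
      by (simp add: d_def power2_norm_eq_inner inner_commute algebra_simps)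
    finally show ?thesis by (simp add: q_def l_def field_simps)
  qed
  have gradD: "norm (\<alpha> *\<^sub>R grad) \<le> D"
  proof -
    have "norm grad \<le> real m * G"
      using sum_norm_le[of "{1..m}" "\<lambda>i. g i (z 1)" "\<lambda>_. G"] G z1 by (simp add: grad_def)
    then show ?thesis using \<alpha> by (simp add: D_def mult.left_commute mult.assoc)
  qed
  have qu: "q * norm u \<le> norm (\<alpha> *\<^sub>R grad)"
  proof (cases "norm u = 0")
    case False
    have "c * (norm u)\<^sup>2 \<le> grad \<bullet> u"
      using below[of xs "z 1"] below[of "z 1" xs] crit
      by (simp add: u_def grad_def norm_minus_commute inner_diff_right field_simps)
    also have "\<dots> \<le> norm grad * norm u" by (rule norm_cauchy_schwarz)
    finally have "c * norm u \<le> norm grad"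
      using False by (simp add: power2_eq_square)
    then show ?thesis using \<alpha> by (simp add: q_def mult.commute mult.left_commute)
  qed simp
  have EL: "norm E \<le> l * b" if b: "\<And>i. i \<in> {1..m} \<Longrightarrow> norm (z 1 - z i) \<le> b" for b
  proof -
    have "norm (\<Sum>i=1..m. g i (z 1) - g i (z i)) \<le> (\<Sum>i=1..m. Li i * b)"
    proof (rule sum_norm_le)
      fix i assume i: "i \<in> {1..m}"
      then have "norm (g i (z 1) - g i (z i)) \<le> Li i * norm (z 1 - z i)"
        using lip[OF i z1, of "z i"] inX[of i] by auto
      also have "\<dots> \<le> Li i * b" using b[OF i] Li[OF i] by (rule mult_left_mono)
      finally show "norm (g i (z 1) - g i (z i)) \<le> Li i * b" .
    qed
    also have "\<dots> = L * b" by (simp add: L sum_distrib_right)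
    finally show ?thesis using \<alpha> by (simp add: E_def l_def mult.assoc)
  qed
  have first: "norm (z 1 - z i) \<le> real (i - 1) * (\<alpha> * G)" if "i \<in> {1..m}" for i
    using path[of 1 "i - 1"] that by (auto simp: norm_minus_commute)
  have ED: "norm E \<le> l * D"
  proof (rule EL)
    fix i assume i: "i \<in> {1..m}"
    have "real (i - 1) * (\<alpha> * G) \<le> real m * (\<alpha> * G)"
      using i G0 \<alpha> by (intro mult_right_mono) auto
    then show "norm (z 1 - z i) \<le> D" using first[OF i] by (simp add: D_def mult.assoc)
  qed
  (* An inner iterate at distance t from the start has used at least t of the total path length D,
     so the cycle ends at distance at least t - (D - t) from the start. With the threshold
     t = (1 - q / 2) D this distance is (1 - q) D. *)
  have alt: "(1 - q) * D \<le> d \<or> norm E \<le> l * (1 - q / 2) * D"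
  proof (cases "\<exists>i\<in>{1..m}. (1 - q / 2) * D < norm (z 1 - z i)")
    case True
    then obtain i where i: "i \<in> {1..m}" and far: "(1 - q / 2) * D < norm (z 1 - z i)" by blast
    have "norm (z (m + 1) - z i) \<le> real (m + 1 - i) * (\<alpha> * G)"
      using path[of i "m + 1 - i"] i by auto
    moreover have "real (m + 1 - i) * (\<alpha> * G) + real (i - 1) * (\<alpha> * G) = D"
      using i by (simp add: D_def of_nat_diff algebra_simps)
    ultimately have "norm (z (m + 1) - z i) \<le> D - norm (z 1 - z i)"
      using first[OF i] by linarith
    moreover have "norm (z 1 - z i) \<le> d + norm (z (m + 1) - z i)"
      using norm_triangle_ineq[of "z 1 - z (m + 1)" "z (m + 1) - z i"]
      by (simp add: d_def u_def v_def)
    ultimately have "2 * ((1 - q / 2) * D) - D \<le> d" using far by linarith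
    then show ?thesis by (simp add: algebra_simps)
  next
    case False
    then have "norm E \<le> l * ((1 - q / 2) * D)" by (intro EL) (auto simp: not_less)
    then show ?thesis by (simp add: mult.assoc)
  qed
  have "norm v \<le> max ((1 - q) * norm u + l * D) (l * D / q)"
  proof (rule quadratic_recursion_imp_linear[OF ql D0 _ _ quad _ ED _ alt])
    show "q * norm u \<le> D" using qu gradD by linarith
    have "\<alpha> *\<^sub>R grad = u - v + E" using v by (simp add: algebra_simps)
    then have "norm (\<alpha> *\<^sub>R grad) \<le> d + norm E"
      by (simp only: d_def norm_triangle_ineq)
    then show "q * norm u - l * D \<le> d" using qu ED by linarith
  qed auto
  moreover have "l * D = \<alpha>\<^sup>2 * (L * G * real m)"
    by (simp add: l_def D_def power2_eq_square)
  moreover have "l * D / q = \<alpha> * (L * G * real m) / c"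
    using \<alpha> c by (simp add: l_def D_def q_def)
  ultimately show ?thesis by (simp add: u_def v_def q_def)
qed

section \<open>Asymptotics of the distance recursion\<close>

text \<open>The comparison is an induction from an index \<open>N\<close> after which all the eventual conditions
  hold. The constant is chosen last, from the value \<open>d N\<close>, which is possible because the
  recursive inequality for \<open>H\<close> is preserved when \<open>H\<close> is multiplied by \<open>C \<ge> 0\<close>.\<close>

lemma recursion_bounded_by_supersolution:
  fixes d q e K A H :: "nat \<Rightarrow> real"
  assumes rec: "\<forall>\<^sub>F k in sequentially. d (Suc k) \<le> max ((1 - q k) * d k + e k) (K k)"
    and q: "\<forall>\<^sub>F k in sequentially. q k \<le> 1"
    and A: "\<forall>\<^sub>F k in sequentially. (1 - q k) * A k + e k \<le> A (Suc k)"
    and AK: "\<forall>\<^sub>F k in sequentially. K k \<le> A (Suc k)"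
    and H: "\<forall>\<^sub>F k in sequentially. (1 - q k) * H k \<le> H (Suc k)"
    and Hpos: "\<forall>\<^sub>F k in sequentially. 0 < H k"
  shows "\<exists>C. \<forall>\<^sub>F k in sequentially. d k \<le> A k + C * H k"
proof -
  obtain N where N: "\<And>k. N \<le> k \<Longrightarrow> d (Suc k) \<le> max ((1 - q k) * d k + e k) (K k) \<and> q k \<le> 1 \<and>
      (1 - q k) * A k + e k \<le> A (Suc k) \<and> K k \<le> A (Suc k) \<and>
      (1 - q k) * H k \<le> H (Suc k) \<and> 0 < H k"
    using eventually_conj[OF rec eventually_conj[OF q eventually_conj[OF A
          eventually_conj[OF AK eventually_conj[OF H Hpos]]]]]
    by (auto simp: eventually_sequentially)
  define C where "C = max 0 ((d N - A N) / H N)"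
  have "d k \<le> A k + C * H k" if "N \<le> k" for k
    using that
  proof (induction k rule: dec_induct)
    case base
    have "d N - A N = (d N - A N) / H N * H N" using N[of N] by simp
    also have "\<dots> \<le> C * H N"
      using N[of N] by (intro mult_right_mono) (auto simp: C_def)
    finally show ?case by simp
  next
    case (step k)
    note N = N[OF step(1)]
    have C: "0 \<le> C" by (simp add: C_def)
    have "(1 - q k) * d k + e k \<le> (1 - q k) * (A k + C * H k) + e k"
      using N step.IH by (intro add_right_mono mult_left_mono) auto
    also have "\<dots> = ((1 - q k) * A k + e k) + C * ((1 - q k) * H k)"
      by (simp add: algebra_simps)
    also have "\<dots> \<le> A (Suc k) + C * H (Suc k)"
      using N C by (intro add_mono mult_left_mono) auto
    finally have "(1 - q k) * d k + e k \<le> A (Suc k) + C * H (Suc k)" .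
    moreover have "K k \<le> A (Suc k) + C * H (Suc k)"
    proof -
      have "q k \<le> 1" "(1 - q k) * H k \<le> H (Suc k)" "0 < H k" "K k \<le> A (Suc k)" using N by auto
      then have "0 \<le> H (Suc k)" by (smt (verit) mult_nonneg_nonneg)
      then show ?thesis using \<open>K k \<le> A (Suc k)\<close> C by (smt (verit) mult_nonneg_nonneg)
    qed
    ultimately show ?case using N by (smt (verit))
  qed
  then show ?thesis by (auto simp: eventually_sequentially)
qed

text \<open>This is Bernoulli's inequality \<open>(1 + 1/k)\<^sup>-\<^sup>t \<ge> 1 - t/k\<close>, obtained from
  \<open>ln (1 + 1/k) \<le> 1/k\<close> and \<open>exp y \<ge> 1 + y\<close>. It makes \<open>k\<^sup>-\<^sup>t\<close> a supersolution of every homogeneous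
  recursion whose factor is at most \<open>1 - t/k\<close>.\<close>

lemma powr_neg_supersolution:
  assumes "0 \<le> t" "1 \<le> k"
  shows "(1 - t / real k) * real k powr (- t) \<le> real (Suc k) powr (- t)"
proof -
  have k: "0 < real k" using assms by simp
  have "1 - t / real k \<le> exp (- t / real k)"
    using exp_ge_add_one_self[of "- t / real k"] by simp
  also have "\<dots> \<le> exp (- t * ln (1 + 1 / real k))"
    using ln_add_one_self_le_self[of "1 / real k"] assms k
    by (simp add: mult_left_mono) (metis mult.right_neutral mult_left_mono times_divide_eq_right)
  also have "\<dots> = (1 + 1 / real k) powr (- t)"
    using k add_pos_pos[of 1 "1 / real k"] by (auto simp: powr_def)
  finally have "(1 - t / real k) * real k powr (- t) \<le> (1 + 1 / real k) powr (- t) * real k powr (- t)"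
    by (rule mult_right_mono) simp
  also have "\<dots> = ((1 + 1 / real k) * real k) powr (- t)"
    using k by (simp add: powr_mult)
  also have "(1 + 1 / real k) * real k = real (Suc k)"
    using k by (simp add: field_simps)
  finally show ?thesis .
qed

lemma limsup_le_of_eventually_le:
  fixes a b :: "nat \<Rightarrow> real"
  assumes "\<forall>\<^sub>F k in sequentially. a k \<le> b k" and "b \<longlonglongrightarrow> l"
  shows "limsup (\<lambda>k. ereal (a k)) \<le> ereal l"
proof -
  have "limsup (\<lambda>k. ereal (a k)) \<le> limsup (\<lambda>k. ereal (b k))"
    using assms(1) by (intro Limsup_mono) auto
  also have "\<dots> = ereal l"
    using assms(2) by (intro lim_imp_Limsup) auto
  finally show ?thesis .
qed

text \<open>With \<open>p = R c > 1\<close>, substituting \<open>a/k\<close> into the recursion leaves a surplus of at least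
  \<open>a (p - 1)/k\<^sup>2\<close>, and the limit constant is the value of \<open>a\<close> at which this balances
  \<open>R\<^sup>2 M/k\<^sup>2\<close>. The homogeneous part \<open>k\<^sup>-\<^sup>p\<close> decays faster than \<open>1/k\<close> and disappears in the limit.\<close>

lemma limsup_recursion_large_step:
  fixes d :: "nat \<Rightarrow> real"
  assumes rec: "\<forall>\<^sub>F k in sequentially. d (Suc k) \<le>
      max ((1 - c * (R / real k)) * d k + (R / real k)\<^sup>2 * M) (R / real k * M / c)"
    and c: "0 < c" and R: "0 < R" "1 / c < R" and M: "0 \<le> M"
  shows "limsup (\<lambda>k. ereal (real k * d k)) \<le> ereal (R\<^sup>2 * M / (R * c - 1))"
proof -
  define p where "p = R * c"
  have p: "1 < p" using c R by (simp add: p_def field_simps)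
  define a where "a = R\<^sup>2 * M / (p - 1)"
  have a: "a * (p - 1) = R\<^sup>2 * M" "0 \<le> a" using p M by (auto simp: a_def)
  have "\<exists>C. \<forall>\<^sub>F k in sequentially. d k \<le> a / real k + C * real k powr (- p)"
  proof (rule recursion_bounded_by_supersolution[OF rec])
    show "\<forall>\<^sub>F k in sequentially. c * (R / real k) \<le> 1"
      by real_asymp
    show "\<forall>\<^sub>F k in sequentially.
        (1 - c * (R / real k)) * (a / real k) + (R / real k)\<^sup>2 * M \<le> a / real (Suc k)"
      using eventually_gt_at_top[of 0]
    proof eventually_elim
      case (elim k)
      have "(1 - c * (R / real k)) * (a / real k) + (R / real k)\<^sup>2 * M
          = a / real k - (a * p - R\<^sup>2 * M) / (real k)\<^sup>2"
        using elim by (simp add: p_def field_simps power2_eq_square)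
      also have "a * p - R\<^sup>2 * M = a" using a(1) by (simp add: algebra_simps)
      also have "a / real k - a / (real k)\<^sup>2 = a * ((real k - 1) / (real k)\<^sup>2)"
        using elim by (simp add: field_simps power2_eq_square)
      also have "\<dots> \<le> a * (1 / real (Suc k))"
        using elim a(2) by (intro mult_left_mono) (auto simp: field_simps power2_eq_square)
      finally show ?case by simp
    qed
    show "\<forall>\<^sub>F k in sequentially. R / real k * M / c \<le> a / real (Suc k)"
      using eventually_gt_at_top[of "nat \<lceil>p\<rceil>"]
    proof eventually_elim
      case (elim k)
      then have k: "p < real k" "0 < real k" using p by linarith+
      have eq: "R / real k * M / c = a * ((p - 1) / (p * real k))"
        using a(1) c R p k by (simp add: p_def field_simps power2_eq_square)
      have "a * ((p - 1) / (p * real k)) \<le> a * (1 / real (Suc k))"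
        using a(2) p k by (intro mult_left_mono) (auto simp: field_simps)
      then show ?case unfolding eq by simp
    qed
    show "\<forall>\<^sub>F k in sequentially.
        (1 - c * (R / real k)) * real k powr (- p) \<le> real (Suc k) powr (- p)"
      using eventually_ge_at_top[of 1]
    proof eventually_elim
      case (elim k)
      then show ?case using powr_neg_supersolution[of p k] p by (simp add: p_def mult.commute)
    qed
    show "\<forall>\<^sub>F k in sequentially. 0 < real k powr (- p)"
      using eventually_gt_at_top[of 0] by eventually_elim simp
  qed
  then obtain C where C: "\<forall>\<^sub>F k in sequentially. d k \<le> a / real k + C * real k powr (- p)" by blast
  show ?thesis
  proof (rule limsup_le_of_eventually_le)
    show "\<forall>\<^sub>F k in sequentially. real k * d k \<le> a + C * real k powr (1 - p)"
      using C eventually_gt_at_top[of 0]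
    proof eventually_elim
      case (elim k)
      then have "real k * d k \<le> real k * (a / real k + C * real k powr (- p))"
        by (intro mult_left_mono) auto
      also have "\<dots> = a + C * real k powr (1 - p)"
        using elim by (simp add: powr_diff powr_minus field_simps)
      finally show ?case .
    qed
    have "(\<lambda>k. real k powr (1 - p)) \<longlonglongrightarrow> 0"
      using p by real_asymp
    then have "(\<lambda>k. a + C * real k powr (1 - p)) \<longlonglongrightarrow> a + C * 0"
      by (intro tendsto_intros)
    then show "(\<lambda>k. a + C * real k powr (1 - p)) \<longlonglongrightarrow> R\<^sup>2 * M / (R * c - 1)"
      by (simp add: a_def p_def)
  qed
qed

text \<open>For \<open>R c = 1\<close> the homogeneous solution \<open>1/k\<close> resonates with the inhomogeneity:
  \<open>k d k\<close> grows by \<open>O(1/k)\<close> per step, which the increments of \<open>a ln k\<close> absorb. The factor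
  \<open>4\<close> in \<open>a\<close> comes from \<open>(k + 1)\<^sup>2 \<le> 4 k\<^sup>2\<close>; adding \<open>1\<close> makes \<open>a\<close> positive also when \<open>M = 0\<close>.\<close>

lemma limsup_recursion_critical_step:
  fixes d :: "nat \<Rightarrow> real"
  assumes rec: "\<forall>\<^sub>F k in sequentially. d (Suc k) \<le>
      max ((1 - c * (R / real k)) * d k + (R / real k)\<^sup>2 * M) (R / real k * M / c)"
    and c: "0 < c" and R: "R = 1 / c" and M: "0 \<le> M"
  shows "limsup (\<lambda>k. ereal (real k / ln (real k) * d k)) < \<infinity>"
proof -
  define a where "a = 4 * R\<^sup>2 * M + 1"
  have a: "0 < a" using M by (simp add: a_def add_nonneg_pos)
  have cR: "c * R = 1" "0 < R" using c R by simp_all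
  have "\<exists>C. \<forall>\<^sub>F k in sequentially. d k \<le> a * ln (real k) / real k + C * (1 / real k)"
  proof (rule recursion_bounded_by_supersolution[OF rec])
    show "\<forall>\<^sub>F k in sequentially. c * (R / real k) \<le> 1"
      by real_asymp
    show "\<forall>\<^sub>F k in sequentially.
        (1 - c * (R / real k)) * (a * ln (real k) / real k) + (R / real k)\<^sup>2 * M
          \<le> a * ln (real (Suc k)) / real (Suc k)"
      using eventually_ge_at_top[of 1]
    proof eventually_elim
      case (elim k)
      then have k: "1 \<le> real k" by simp
      have "ln (real k / real (Suc k)) \<le> real k / real (Suc k) - 1"
        using k by (intro ln_le_minus_one) auto
      then have lnS: "ln (real k) + 1 / real (Suc k) \<le> ln (real (Suc k))"
        using k by (simp add: ln_div field_simps)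
      have "(1 - c * (R / real k)) * (a * ln (real k) / real k) + (R / real k)\<^sup>2 * M
          = a * ln (real k) * ((real k - 1) / (real k)\<^sup>2) + R\<^sup>2 * M / (real k)\<^sup>2"
        using k cR by (simp add: field_simps power2_eq_square)
      also have "\<dots> \<le> a * ln (real k) * (1 / real (Suc k)) + a / (real (Suc k))\<^sup>2"
      proof (rule add_mono)
        show "a * ln (real k) * ((real k - 1) / (real k)\<^sup>2) \<le> a * ln (real k) * (1 / real (Suc k))"
          using a k by (intro mult_left_mono) (auto simp: field_simps power2_eq_square)
        have "R\<^sup>2 * M * (real (Suc k))\<^sup>2 \<le> R\<^sup>2 * M * (2 * real k)\<^sup>2"
          using k M by (intro mult_left_mono power_mono) auto
        also have "\<dots> \<le> a * (real k)\<^sup>2"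
          using k by (simp add: a_def algebra_simps)
        finally show "R\<^sup>2 * M / (real k)\<^sup>2 \<le> a / (real (Suc k))\<^sup>2"
          using k by (simp add: divide_simps)
      qed
      also have "\<dots> = a * (ln (real k) + 1 / real (Suc k)) / real (Suc k)"
        by (simp add: add_divide_distrib distrib_left power2_eq_square)
      also have "\<dots> \<le> a * ln (real (Suc k)) / real (Suc k)"
        using lnS a by (intro divide_right_mono mult_left_mono) auto
      finally show ?case .
    qed
    define B where "B = 2 * (R * M / c) / a"
    have "\<forall>\<^sub>F k in sequentially. B \<le> ln (real (Suc k))"
      by real_asymp
    then show "\<forall>\<^sub>F k in sequentially. R / real k * M / c \<le> a * ln (real (Suc k)) / real (Suc k)"
      using eventually_ge_at_top[of 1]
    proof eventually_elim
      case (elim k)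
      have "R / real k * M / c = R * M / c * (1 / real k)" by simp
      also have "\<dots> \<le> R * M / c * (2 / real (Suc k))"
        using elim cR M c by (intro mult_left_mono) (auto simp: field_simps)
      also have "\<dots> = a * B / real (Suc k)" using a by (simp add: B_def)
      also have "\<dots> \<le> a * ln (real (Suc k)) / real (Suc k)"
        using elim a by (intro divide_right_mono mult_left_mono) auto
      finally show ?case .
    qed
    show "\<forall>\<^sub>F k in sequentially. (1 - c * (R / real k)) * (1 / real k) \<le> 1 / real (Suc k)"
      using eventually_ge_at_top[of 1]
    proof eventually_elim
      case (elim k)
      then show ?case using powr_neg_supersolution[of 1 k] cR by (simp add: powr_minus_divide)
    qed
    show "\<forall>\<^sub>F k in sequentially. 0 < 1 / real k"
      by real_asymp
  qed
  then obtain C where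
    C: "\<forall>\<^sub>F k in sequentially. d k \<le> a * ln (real k) / real k + C * (1 / real k)" by blast
  have "limsup (\<lambda>k. ereal (real k / ln (real k) * d k)) \<le> ereal a"
  proof (rule limsup_le_of_eventually_le)
    show "\<forall>\<^sub>F k in sequentially. real k / ln (real k) * d k \<le> a + C / ln (real k)"
      using C eventually_gt_at_top[of 1]
    proof eventually_elim
      case (elim k)
      then have k: "0 < ln (real k)" "0 < real k" by auto
      then have "real k / ln (real k) * d k
          \<le> real k / ln (real k) * (a * ln (real k) / real k + C * (1 / real k))"
        using elim by (intro mult_left_mono) auto
      also have "\<dots> = a + C / ln (real k)"
        using k by (simp add: field_simps)
      finally show ?case .
    qed
    show "(\<lambda>k. a + C / ln (real k)) \<longlonglongrightarrow> a"
      by real_asymp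
  qed
  then show ?thesis by (rule order.strict_trans1) simp
qed

text \<open>For \<open>p = R c < 1\<close> the homogeneous solution \<open>k\<^sup>-\<^sup>p\<close> dominates, and the inhomogeneity is
  absorbed by a negative multiple of \<open>1/k\<close>. The multiple \<open>b k\<^sup>-\<^sup>p\<close> in the particular supersolution
  keeps it above the second argument of the maximum.\<close>

lemma limsup_recursion_small_step:
  fixes d :: "nat \<Rightarrow> real"
  assumes rec: "\<forall>\<^sub>F k in sequentially. d (Suc k) \<le>
      max ((1 - c * (R / real k)) * d k + (R / real k)\<^sup>2 * M) (R / real k * M / c)"
    and c: "0 < c" and R: "0 < R" "R < 1 / c" and M: "0 \<le> M"
  shows "limsup (\<lambda>k. ereal (real k powr (R * c) * d k)) < \<infinity>"
proof -
  define p where "p = R * c"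
  have p: "0 < p" "p < 1" using c R by (auto simp: p_def field_simps)
  define a where "a = 2 * R\<^sup>2 * M / (1 - p)"
  have a: "a * (1 - p) = 2 * (R\<^sup>2 * M)" "0 \<le> a" using p M by (auto simp: a_def)
  have pow: "(1 - c * (R / real k)) * real k powr (- p) \<le> real (Suc k) powr (- p)"
    if "1 \<le> k" for k
    using powr_neg_supersolution[of p k] p that by (simp add: p_def mult.commute)
  define b where "b = 1 + a + 2 * R * M / c"
  have "\<exists>C. \<forall>\<^sub>F k in sequentially. d k \<le>
      (b * real k powr (- p) - a / real k) + C * real k powr (- p)"
  proof (rule recursion_bounded_by_supersolution[OF rec])
    show "\<forall>\<^sub>F k in sequentially. c * (R / real k) \<le> 1"
      by real_asymp
    have "\<forall>\<^sub>F k in sequentially. (1 + p) / 2 \<le> real k / real (Suc k)"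
      using p by real_asymp
    then show "\<forall>\<^sub>F k in sequentially.
        (1 - c * (R / real k)) * (b * real k powr (- p) - a / real k) + (R / real k)\<^sup>2 * M
          \<le> b * real (Suc k) powr (- p) - a / real (Suc k)"
      using eventually_ge_at_top[of 1]
    proof eventually_elim
      case (elim k)
      then have k: "1 \<le> real k" by simp
      have "b * ((1 - c * (R / real k)) * real k powr (- p)) \<le> b * real (Suc k) powr (- p)"
        using pow[OF elim(2)] a M R c by (intro mult_left_mono) (auto simp: b_def)
      moreover have "(R / real k)\<^sup>2 * M + a / real (Suc k) \<le> (1 - c * (R / real k)) * (a / real k)"
      proof -
        have "2 * (R\<^sup>2 * M) = a * (1 - p)" using a by simp
        also have "\<dots> \<le> a * (2 * (real k / real (Suc k) - p))"
        proof (rule mult_left_mono[OF _ a(2)])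
          have "1 - p \<le> 2 * (y - p)" if "(1 + p) / 2 \<le> y" for y using that by simp
          then show "1 - p \<le> 2 * (real k / real (Suc k) - p)" using elim(1) by blast
        qed
        also have "\<dots> = 2 * (a * (real k / real (Suc k) - p))" by (rule mult.left_commute)
        finally have "R\<^sup>2 * M \<le> a * (real k / real (Suc k) - p)"
          by (simp only: mult_le_cancel_left_pos zero_less_numeral)
        then have "R\<^sup>2 * M / (real k)\<^sup>2 \<le> a * (real k / real (Suc k) - p) / (real k)\<^sup>2"
          by (rule divide_right_mono) simp
        also have "\<dots> = (1 - c * (R / real k)) * (a / real k) - a / real (Suc k)"
          using k by (simp add: p_def divide_simps) (simp add: algebra_simps power2_eq_square)
        finally show ?thesis by (simp add: power_divide)
      qed
      ultimately show ?case by (simp add: algebra_simps)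
    qed
    show "\<forall>\<^sub>F k in sequentially.
        R / real k * M / c \<le> b * real (Suc k) powr (- p) - a / real (Suc k)"
      using eventually_ge_at_top[of 1]
    proof eventually_elim
      case (elim k)
      have "R / real k * M / c = R * M / c * (1 / real k)" by simp
      also have "\<dots> \<le> R * M / c * (2 / real (Suc k))"
        using elim R M c by (intro mult_left_mono) (auto simp: field_simps)
      finally have "R / real k * M / c + a / real (Suc k)
          \<le> R * M / c * (2 / real (Suc k)) + a / real (Suc k)" by simp
      also have "\<dots> = (b - 1) * (1 / real (Suc k))"
        by (simp add: b_def add_divide_distrib)
      also have "\<dots> \<le> b * (1 / real (Suc k))"
        by (intro mult_right_mono) auto
      also have "\<dots> \<le> b * real (Suc k) powr (- p)"
      proof (rule mult_left_mono)
        have "real (Suc k) powr (- 1) \<le> real (Suc k) powr (- p)"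
          using p by (intro powr_mono) auto
        then show "1 / real (Suc k) \<le> real (Suc k) powr (- p)"
          by (simp add: powr_minus_divide)
        show "0 \<le> b" using a R M c by (simp add: b_def)
      qed
      finally show ?case by simp
    qed
    show "\<forall>\<^sub>F k in sequentially.
        (1 - c * (R / real k)) * real k powr (- p) \<le> real (Suc k) powr (- p)"
      using eventually_ge_at_top[of 1] by eventually_elim (rule pow)
    show "\<forall>\<^sub>F k in sequentially. 0 < real k powr (- p)"
      using eventually_gt_at_top[of 0] by eventually_elim simp
  qed
  then obtain C where C: "\<forall>\<^sub>F k in sequentially. d k \<le>
      (b * real k powr (- p) - a / real k) + C * real k powr (- p)" by blast
  have "limsup (\<lambda>k. ereal (real k powr (R * c) * d k)) \<le> ereal (b + C)"
  proof (rule limsup_le_of_eventually_le)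
    show "\<forall>\<^sub>F k in sequentially. real k powr (R * c) * d k \<le> b + C"
      using C eventually_gt_at_top[of 0]
    proof eventually_elim
      case (elim k)
      then have "d k \<le> (b + C) * real k powr (- p)"
        using divide_nonneg_nonneg[OF a(2), of "real k"] by (simp add: algebra_simps)
      then have "real k powr p * d k \<le> real k powr p * ((b + C) * real k powr (- p))"
        by (rule mult_left_mono) simp
      also have "\<dots> = b + C" using elim by (simp add: powr_minus)
      finally show ?case by (simp add: p_def)
    qed
  qed simp
  then show ?thesis by (rule order.strict_trans1) simp
qed

text \<open>For \<open>s < 1\<close> the relative decrease \<open>s/k\<close> of \<open>k\<^sup>-\<^sup>s\<close> is negligible against the contraction
  \<open>c R/k\<^sup>s\<close>. Hence \<open>a k\<^sup>-\<^sup>s\<close> is a supersolution for every \<open>a\<close> strictly above the equilibrium constant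
  \<open>R M/c\<close>, and \<open>1/k\<close> eventually satisfies the homogeneous inequality.\<close>

lemma limsup_recursion_slow_decay:
  fixes d :: "nat \<Rightarrow> real"
  assumes rec: "\<forall>\<^sub>F k in sequentially. d (Suc k) \<le>
      max ((1 - c * (R / real k powr s)) * d k + (R / real k powr s)\<^sup>2 * M)
          (R / real k powr s * M / c)"
    and c: "0 < c" and R: "0 < R" and s: "0 < s" "s < 1" and M: "0 \<le> M"
  shows "limsup (\<lambda>k. ereal (real k powr s * d k)) \<le> ereal (R * M / c)"
proof (rule ereal_le_epsilon2)
  fix \<epsilon> :: real assume \<epsilon>: "0 < \<epsilon>"
  define a where "a = R * M / c + \<epsilon>"
  have a: "0 < a" using R M c \<epsilon> by (simp add: a_def add_nonneg_pos)
  have gap: "R * (a * c - R * M) > 0" using c \<epsilon> R by (simp add: a_def algebra_simps)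
  have "\<exists>C. \<forall>\<^sub>F k in sequentially. d k \<le> a * real k powr (- s) + C * real k powr (- 1)"
  proof (rule recursion_bounded_by_supersolution[OF rec])
    show "\<forall>\<^sub>F k in sequentially. c * (R / real k powr s) \<le> 1"
      using s by real_asymp
    have "\<forall>\<^sub>F k in sequentially. a * s * real k powr (s - 1) \<le> R * (a * c - R * M)"
      using s gap by real_asymp
    then show "\<forall>\<^sub>F k in sequentially.
        (1 - c * (R / real k powr s)) * (a * real k powr (- s)) + (R / real k powr s)\<^sup>2 * M
          \<le> a * real (Suc k) powr (- s)"
      using eventually_ge_at_top[of 1]
    proof eventually_elim
      case (elim k)
      define w where "w = real k powr (- s)"
      have w: "1 / real k powr s = w" by (simp add: w_def powr_minus_divide)
      have "real k powr (s - 1) * w = real k powr (- 1)"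
        by (simp add: w_def flip: powr_add)
      then have ws: "real k powr (s - 1) * w = 1 / real k"
        using elim by (simp add: powr_minus_divide)
      have "(1 - c * (R / real k powr s)) * (a * w) + (R / real k powr s)\<^sup>2 * M
          = (1 - c * (R * (1 / real k powr s))) * (a * w) + (R * (1 / real k powr s))\<^sup>2 * M"
        by simp
      also have "\<dots> = a * w - R * (a * c - R * M) * w\<^sup>2"
        unfolding w by (simp add: algebra_simps power2_eq_square)
      also have "\<dots> \<le> a * w - (a * s * real k powr (s - 1)) * w\<^sup>2"
        using elim by (intro diff_left_mono mult_right_mono) auto
      also have "\<dots> = a * w - a * s * (real k powr (s - 1) * w) * w"
        by (simp add: power2_eq_square)
      also have "\<dots> = a * ((1 - s / real k) * w)"
        unfolding ws by (simp add: algebra_simps)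
      also have "\<dots> \<le> a * real (Suc k) powr (- s)"
        using powr_neg_supersolution[of s k] elim s a unfolding w_def
        by (intro mult_left_mono) auto
      finally show ?case unfolding w_def .
    qed
    have aRM: "R * M / c < a" using \<epsilon> by (simp add: a_def)
    have "(\<lambda>k. a * (real k / real (Suc k)) powr s) \<longlonglongrightarrow> a"
      using s a by real_asymp
    then have "\<forall>\<^sub>F k in sequentially. R * M / c < a * (real k / real (Suc k)) powr s"
      using aRM by (rule order_tendstoD)
    then show "\<forall>\<^sub>F k in sequentially. R / real k powr s * M / c \<le> a * real (Suc k) powr (- s)"
      using eventually_ge_at_top[of 1]
    proof eventually_elim
      case (elim k)
      have "R / real k powr s * M / c = R * M / c * (1 / real k powr s)" by simp
      also have "\<dots> \<le> a * (real k / real (Suc k)) powr s * (1 / real k powr s)"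
        using elim by (intro mult_right_mono) auto
      also have "\<dots> = a * real (Suc k) powr (- s)"
        using elim by (simp add: powr_divide powr_minus_divide)
      finally show ?case .
    qed
    have "\<forall>\<^sub>F k in sequentially. 1 / real k \<le> c * (R / real k powr s)"
      using s c R by real_asymp
    then show "\<forall>\<^sub>F k in sequentially.
        (1 - c * (R / real k powr s)) * real k powr (- 1) \<le> real (Suc k) powr (- 1)"
      using eventually_ge_at_top[of 1]
    proof eventually_elim
      case (elim k)
      have "(1 - c * (R / real k powr s)) * real k powr (- 1) \<le> (1 - 1 / real k) * real k powr (- 1)"
        using elim by (intro mult_right_mono) auto
      then show ?case using powr_neg_supersolution[of 1 k] elim by linarith
    qed
    show "\<forall>\<^sub>F k in sequentially. 0 < real k powr (- 1)"
      using eventually_gt_at_top[of 0] by eventually_elim simp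
  qed
  then obtain C where
    C: "\<forall>\<^sub>F k in sequentially. d k \<le> a * real k powr (- s) + C * real k powr (- 1)" by blast
  have "limsup (\<lambda>k. ereal (real k powr s * d k)) \<le> ereal a"
  proof (rule limsup_le_of_eventually_le)
    show "\<forall>\<^sub>F k in sequentially. real k powr s * d k \<le> a + C * real k powr (s - 1)"
      using C eventually_gt_at_top[of 0]
    proof eventually_elim
      case (elim k)
      then have "real k powr s * d k \<le> real k powr s * (a * real k powr (- s) + C * real k powr (- 1))"
        by (intro mult_left_mono) auto
      also have "\<dots> = a * (real k powr s * real k powr (- s)) + C * (real k powr s * real k powr (- 1))"
        by (simp add: algebra_simps)
      also have "\<dots> = a + C * real k powr (s - 1)"
        using elim unfolding powr_add[symmetric] by simp
      finally show ?case .
    qed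
    have "(\<lambda>k. real k powr (s - 1)) \<longlonglongrightarrow> 0"
      using s by real_asymp
    then have "(\<lambda>k. a + C * real k powr (s - 1)) \<longlonglongrightarrow> a + C * 0"
      by (intro tendsto_intros)
    then show "(\<lambda>k. a + C * real k powr (s - 1)) \<longlonglongrightarrow> a"
      by simp
  qed
  then show "limsup (\<lambda>k. ereal (real k powr s * d k)) \<le> ereal (R * M / c) + ereal \<epsilon>"
    by (simp add: a_def)
qed

text \<open>The set of values at most \<open>K\<close> is invariant, since \<open>K\<close> is the fixed point of the affine map;
  above \<open>K\<close> the excess shrinks by the factor \<open>1 - q\<close>.\<close>

lemma linear_recursion_geometric_bound:
  fixes d :: "nat \<Rightarrow> real"
  assumes rec: "\<And>k. 1 \<le> k \<Longrightarrow> d (k + 1) \<le> max ((1 - q) * d k + q * K) K"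
    and q: "q \<le> 1" and nonneg: "0 \<le> K" "0 \<le> d 1" and "1 \<le> k"
  shows "d (k + 1) \<le> (1 - q) ^ k * d 1 + K"
  using \<open>1 \<le> k\<close>
proof (induction k rule: dec_induct)
  case base
  have "q * K \<le> 1 * K" using q nonneg by (intro mult_right_mono) auto
  then have "(1 - q) * d 1 + q * K \<le> (1 - q) * d 1 + K" by simp
  moreover have "0 \<le> (1 - q) * d 1" using q nonneg by simp
  ultimately show ?case using rec[of 1] by simp
next
  case (step k)
  have "(1 - q) * d (k + 1) + q * K \<le> (1 - q) * ((1 - q) ^ k * d 1 + K) + q * K"
    using step.IH q by (intro add_right_mono mult_left_mono) auto
  also have "\<dots> = (1 - q) ^ Suc k * d 1 + K" by (simp add: algebra_simps)
  finally have "(1 - q) * d (k + 1) + q * K \<le> (1 - q) ^ Suc k * d 1 + K" .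
  moreover have "0 \<le> (1 - q) ^ Suc k * d 1" using q nonneg by simp
  ultimately show ?case using rec[of "Suc k"] by simp
qed

section \<open>Convergence rates of the incremental gradient method\<close>

theorem theorem3p2:
  fixes m :: nat
    and f :: "nat \<Rightarrow> real ^ 'n \<Rightarrow> real"
    and F :: "real ^ 'n \<Rightarrow> real"
    and x :: "nat \<Rightarrow> nat \<Rightarrow> real ^ 'n"
    and xstar a :: "real ^ 'n"
    and X :: "(real ^ 'n) set"
    and \<alpha> dist_to_opt :: "nat \<Rightarrow> real"
    and Li :: "nat \<Rightarrow> real"
    and c R s r G L M :: real
  assumes convex: "\<forall>i\<in>{1..m}. convex_on UNIV (f i)"
    and smooth: "\<forall>i\<in>{1..m}. twice_continuously_differentiable (f i)"
    and F: "F = (\<lambda>z. \<Sum>i=1..m. f i z)"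
    and c: "c > 0"
    and strong: "strongly_convex c F"
    and minimizer: "is_arg_min F (\<lambda>_. True) xstar"
    and R: "R > 0"
    and s: "0 \<le> s" "s \<le> 1"
    and stepsize: "\<forall>k\<ge>1. \<alpha> k = R / real k powr s"
    and IG: "incremental_gradient m f \<alpha> x"
    and ball: "r \<ge> 0" "X = cball a r"
    and bounded: "\<forall>k\<ge>1. \<forall>i\<in>{1..m}. x k i \<in> X"
    and G: "\<forall>i\<in>{1..m}. \<forall>z\<in>X. norm (gradient (f i) z) \<le> G"
    and Li: "\<forall>i\<in>{1..m}. Li i = (SUP z\<in>X. spectral_norm (hessian (f i) z))"
    and L: "L = (\<Sum>i=1..m. Li i)"
    and M: "M = L * G * real m"
    and dist_to_opt: "\<forall>k\<ge>1. dist_to_opt k = norm (x k 1 - xstar)"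
  shows "(s = 1 \<longrightarrow>
            (R > 1 / c \<longrightarrow>
               limsup (\<lambda>k. ereal (real k * dist_to_opt k)) \<le> ereal (R\<^sup>2 * M / (R * c - 1))) \<and>
            (R = 1 / c \<longrightarrow>
               limsup (\<lambda>k. ereal (real k / ln (real k) * dist_to_opt k)) < \<infinity>) \<and>
            (R < 1 / c \<longrightarrow>
               limsup (\<lambda>k. ereal (real k powr (R * c) * dist_to_opt k)) < \<infinity>)) \<and>
         (0 < s \<and> s < 1 \<longrightarrow>
            limsup (\<lambda>k. ereal (real k powr s * dist_to_opt k)) \<le> ereal (R * M / c)) \<and>
         (s = 0 \<and> R \<le> 1 / L \<longrightarrow>
            (\<forall>k\<ge>1. dist_to_opt (k + 1) \<le> (1 - c * R) ^ k * dist_to_opt 1 + R * M / c))"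
proof -
  define g where "g i z = gradient (f i) z" for i z
  have X: "compact X" "convex X" "X \<noteq> {}" using ball by auto
  have diff: "f i differentiable (at z)" if "i \<in> {1..m}" for i z
    using smooth that by (auto simp: twice_continuously_differentiable_def)
  have lip: "norm (g i p - g i w) \<le> Li i * norm (p - w)"
    if "i \<in> {1..m}" "p \<in> X" "w \<in> X" for i p w
    using gradient_lipschitz[of "f i" X p w] smooth Li X that by (simp add: g_def)
  have Li0: "0 \<le> Li i" if i: "i \<in> {1..m}" for i
  proof -
    have "spectral_norm (hessian (f i) a) \<le> (SUP z\<in>X. spectral_norm (hessian (f i) z))"
      using smooth i X ball by (intro cSUP_upper bdd_above_spectral_norm_hessian) auto
    then show ?thesis using Li i spectral_norm_nonneg[of "hessian (f i) a"] by auto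
  qed
  have L0: "0 \<le> L" unfolding L using Li0 by (rule sum_nonneg)
  have G0: "0 \<le> G" if "m \<noteq> 0"
  proof -
    have "norm (gradient (f 1) a) \<le> G" using G that ball by auto
    then show ?thesis by (rule order_trans[OF norm_ge_zero])
  qed
  have M0: "0 \<le> M" unfolding M using L0 G0 by (cases "m = 0") auto
  have derF: "(F has_derivative (\<lambda>h. (\<Sum>i=1..m. g i z) \<bullet> h)) (at z)" for z
  proof -
    have "((\<lambda>z. \<Sum>i=1..m. f i z) has_derivative (\<lambda>h. \<Sum>i=1..m. g i z \<bullet> h)) (at z)"
      unfolding g_def by (intro has_derivative_sum has_derivative_gradient diff) auto
    then show ?thesis by (simp add: F inner_sum_left)
  qed
  have below: "F w \<ge> F p + (\<Sum>i=1..m. g i p) \<bullet> (w - p) + c / 2 * (norm (w - p))\<^sup>2" for p w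
    by (rule strongly_convex_above_tangent[OF strong derF])
  have above: "F w \<le> F p + (\<Sum>i=1..m. g i p) \<bullet> (w - p) + L / 2 * (norm (w - p))\<^sup>2"
    if "p \<in> X" "w \<in> X" for p w
  proof -
    have "F w \<le> (\<Sum>i=1..m. f i p + g i p \<bullet> (w - p) + Li i / 2 * (norm (w - p))\<^sup>2)"
      unfolding F g_def
    proof (rule sum_mono, rule descent_inequality[OF diff X(2) that])
      fix i y z assume "i \<in> {1..m}" "y \<in> X" "z \<in> X"
      then show "norm (gradient (f i) y - gradient (f i) z) \<le> Li i * norm (y - z)"
        using lip by (simp add: g_def)
    qed auto
    then show ?thesis
      by (simp add: F L sum.distrib inner_sum_left sum_distrib_right sum_divide_distrib)
  qed
  have crit: "(\<Sum>i=1..m. g i xstar) = 0"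
    by (rule gradient_zero_at_minimizer[OF derF minimizer])
  have step: "x k (i + 1) = x k i - \<alpha> k *\<^sub>R g i (x k i)" if "1 \<le> k" "i \<in> {1..m}" for k i
    using IG that by (simp add: incremental_gradient_def g_def)
  have cyc: "x (k + 1) 1 = x k (m + 1)" if "1 \<le> k" for k
    using IG that by (simp add: incremental_gradient_def)
  have inX: "x k i \<in> X" if "1 \<le> k" "i \<in> {1..m + 1}" "m \<noteq> 0" for k i
  proof (cases "i = m + 1")
    case True
    have "x (k + 1) 1 \<in> X" using bounded that by simp
    then show ?thesis using True cyc[OF that(1)] by simp
  qed (use bounded that in auto)
  have pos: "0 < \<alpha> k" if "1 \<le> k" for k
    using stepsize R that by simp

  (* If an outer iterate differs from xstar then its full gradient is nonzero, so the cycle moves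
     within X, and X contains two distinct points at which c and L can be compared. *)
  have comparable_or_optimal: "(m \<noteq> 0 \<and> c \<le> L) \<or> (\<forall>k\<ge>1. dist_to_opt k = 0)"
  proof (rule disjCI)
    assume "\<not> (\<forall>k\<ge>1. dist_to_opt k = 0)"
    then obtain k where k: "1 \<le> k" and ne: "x k 1 \<noteq> xstar" using dist_to_opt by auto
    have grad: "(\<Sum>i=1..m. g i (x k 1)) \<noteq> 0"
    proof
      assume "(\<Sum>i=1..m. g i (x k 1)) = 0"
      then have "c * (norm (x k 1 - xstar))\<^sup>2 \<le> 0"
        using below[of xstar "x k 1"] below[of "x k 1" xstar] crit
        by (simp add: norm_minus_commute)
      then show False using ne c by (simp add: mult_le_0_iff)
    qed
    then have m: "m \<noteq> 0" by (cases "m = 0") auto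
    have "\<exists>i\<in>{1..m}. x k (i + 1) \<noteq> x k i"
    proof (rule ccontr)
      assume "\<not> ?thesis"
      then have stay: "x k (i + 1) = x k i" if "i \<in> {1..m}" for i using that by blast
      have "x k i = x k 1" if "1 \<le> i" "i \<le> m" for i
        using that
      proof (induction i rule: dec_induct)
        case (step i)
        then show ?case using stay[of i] by simp
      qed simp
      moreover have "g i (x k i) = 0" if "i \<in> {1..m}" for i
        using step[OF k that] stay[OF that] pos[OF k] by simp
      ultimately have "(\<Sum>i=1..m. g i (x k 1)) = 0"
        by (intro sum.neutral) (metis atLeastAtMost_iff)
      then show False using grad by simp
    qed
    then obtain i where i: "i \<in> {1..m}" "x k (i + 1) \<noteq> x k i" by blast
    have "c \<le> L"
      using inX[OF k _ m] i
      by (intro strong_convexity_le_smoothness[OF below above]) auto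
    then show "m \<noteq> 0 \<and> c \<le> L" using m by simp
  qed

  have cycle: "dist_to_opt (k + 1) \<le> max ((1 - c * \<alpha> k) * dist_to_opt k + (\<alpha> k)\<^sup>2 * M) (\<alpha> k * M / c)"
    if k: "1 \<le> k" and \<alpha>L: "\<alpha> k * L \<le> 1" for k
    using comparable_or_optimal
  proof
    assume mc: "m \<noteq> 0 \<and> c \<le> L"
    have "norm (x k (m + 1) - xstar) \<le>
        max ((1 - c * \<alpha> k) * norm (x k 1 - xstar) + (\<alpha> k)\<^sup>2 * (L * G * real m))
            (\<alpha> k * (L * G * real m) / c)"
    proof (rule incremental_cycle_bound[where X = X and g = g and F = F,
          OF _ _ lip _ Li0 L below above crit c _ pos[OF k] \<alpha>L])
      show "norm (g i p) \<le> G" if "i \<in> {1..m}" "p \<in> X" for i p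
        using G that by (simp add: g_def)
    qed (use step inX k mc in auto)
    then show ?thesis using cyc k dist_to_opt by (simp add: M)
  next
    assume "\<forall>k\<ge>1. dist_to_opt k = 0"
    then show ?thesis using k M0 pos[OF k] c by (simp add: le_max_iff_disj)
  qed

  have eventual: "\<forall>\<^sub>F k in sequentially. dist_to_opt (Suc k) \<le>
      max ((1 - c * (R / real k powr s)) * dist_to_opt k + (R / real k powr s)\<^sup>2 * M)
          (R / real k powr s * M / c)" if "0 < s"
  proof -
    have "\<forall>\<^sub>F k in sequentially. R / real k powr s * L \<le> 1"
      using that by real_asymp
    then show ?thesis using eventually_ge_at_top[of 1]
    proof eventually_elim
      case (elim k)
      then show ?case using cycle[of k] stepsize by simp
    qed
  qed
  have harmonic: "\<forall>\<^sub>F k in sequentially. dist_to_opt (Suc k) \<le>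
      max ((1 - c * (R / real k)) * dist_to_opt k + (R / real k)\<^sup>2 * M) (R / real k * M / c)"
    if "s = 1"
    using eventual that by simp

  have constant_step: "dist_to_opt (k + 1) \<le> (1 - c * R) ^ k * dist_to_opt 1 + R * M / c"
    if s0: "s = 0" and RL: "R \<le> 1 / L" and k: "1 \<le> k" for k
    using comparable_or_optimal
  proof
    assume mc: "m \<noteq> 0 \<and> c \<le> L"
    have RL1: "R * L \<le> 1" using RL mc c by (simp add: field_simps)
    have \<alpha>: "\<alpha> j = R" if "1 \<le> j" for j using stepsize s0 that by simp
    show ?thesis
    proof (rule linear_recursion_geometric_bound[OF _ _ _ _ k])
      show "dist_to_opt (j + 1) \<le> max ((1 - c * R) * dist_to_opt j + c * R * (R * M / c)) (R * M / c)"
        if "1 \<le> j" for j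
        using cycle[OF that] \<alpha>[OF that] RL1 c by (simp add: power2_eq_square)
      have "c * R \<le> L * R" using mc R by simp
      then show "c * R \<le> 1" using RL1 by (simp add: mult.commute)
    qed (use M0 R c dist_to_opt in auto)
  next
    assume "\<forall>k\<ge>1. dist_to_opt k = 0"
    then show ?thesis using M0 R c by simp
  qed
  show ?thesis
    using limsup_recursion_large_step[OF harmonic c R _ M0]
      limsup_recursion_critical_step[OF harmonic c _ M0]
      limsup_recursion_small_step[OF harmonic c R _ M0]
      limsup_recursion_slow_decay[OF eventual c R _ _ M0] constant_step
    by blast
qed

end
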